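(* For every $J\in\mathcal{P}$, let $\lambda_J(x,y)=(\lambda_j(x,y))_{j\in J}$ be defined by $$\lambda_J(x,y)=(A_JA_J^T)^{-1}A_J\nabla_yf(x,y).$$ Then $$\mathcal{K}_J=\left\{(x,y)\in\mathcal{U}\ :\ A_J^T\lambda_J(x,y)=\nabla_yf(x,y),\quad 0\le[a_j^Ty-b_j(x)]\perp\lambda_j(x,y)\ge0\ \ (j\in J)\right\}.$$ In particular, if $\operatorname{rank}A=p$, then $$\mathcal{K}_J=\left\{(x,y)\in\mathcal{U}\ :\ 0\le[A_Jy-b_J(x)]\perp A_J^{-T}\nabla_yf(x,y)\ge0\right\}.$$
   Context: Let $n,p,m$ be positive integers, $[m]=\{1,\dots,m\}$, and let $\mathcal{I}_1$ be a finite (possibly empty) index set. Let $f,h_i$ ($i\in\mathcal{I}_1$) be real polynomials in $(x,y)\in\mathbb{R}^n\times\mathbb{R}^p$, let $a_1,\dots,a_m\in\mathbb{R}^p$ be constant vectors and $b_1,\dots,b_m$ real polynomials in $x\in\mathbb{R}^n$. Let $A\in\mathbb{R}^{m\times p}$ be the matrix with rows $a_1^T,\dots,a_m^T$ and $t=\operatorname{rank}A$. Put $$\mathcal{U}=\{(x,y) : h_i(x,y)\ge 0\ (i\in\mathcal{I}_1),\ a_j^Ty-b_j(x)\ge 0\ (j\in[m])\}.$$ For $J\subseteq[m]$, $A_J$ denotes the submatrix of $A$ with rows $a_j^T$, $j\in J$, and $b_J(x)=(b_j(x))_{j\in J}$. Let $\mathcal{P}=\{J\subseteq[m] : |J|=t,\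 A_J\text{ has full rank}\}$. For vectors $a,b$ (or scalars), $0\le a\perp b\ge0$ means $a\ge0$, $b\ge0$ componentwise and $a^Tb=0$. For $J\in\mathcal{P}$, $\mathcal{K}_J$ is the set of all $(x,y)\in\mathcal{U}$ for which there exists $\lambda_J=(\lambda_j)_{j\in J}\in\mathbb{R}^t$ with $\nabla_yf(x,y)-A_J^T\lambda_J=0$ and $0\le[a_j^Ty-b_j(x)]\perp\lambda_j\ge0$ for all $j\in J$. $A_J^{-T}$ denotes $(A_J^T)^{-1}$. *)

theory Defs
  imports
    "HOL-Analysis.Derivative"
    "Jordan_Normal_Form.DL_Rank_Submatrix"
    "Jordan_Normal_Form.Gauss_Jordan_Elimination"
begin

unbundle no inner_syntax
no_notation Finite_Cartesian_Product.vec_nth (infixl "$" 90)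

text \<open>
  Points of \<open>\<real>\<^sup>d\<close> are elements of \<^term>\<open>carrier_vec d\<close>. Coordinates and rows are counted from 0, so the
  index set \<open>[m]\<close> is \<^term>\<open>{..<m}\<close>. The pair \<open>(x, y)\<close> is passed to a polynomial in \<open>n + p\<close> variables
  as the concatenation \<open>x @\<^sub>v y\<close>.
\<close>

definition real_polynomial :: "nat \<Rightarrow> (real vec \<Rightarrow> real) \<Rightarrow> bool" where
  "real_polynomial d f \<longleftrightarrow>
     (\<exists>(S :: (nat \<Rightarrow> nat) set) c. finite S \<and>
        (\<forall>z \<in> carrier_vec d. f z = (\<Sum>\<alpha>\<in>S. c \<alpha> * (\<Prod>i<d. (z $ i) ^ \<alpha> i))))"

definition grad_y :: "(real vec \<Rightarrow> real) \<Rightarrow> real vec \<Rightarrow> real vec \<Rightarrow> real vec" where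
  "grad_y f x y =
     vec (dim_vec y)
       (\<lambda>k. deriv (\<lambda>s. f (x @\<^sub>v vec (dim_vec y) (\<lambda>l. if l = k then s else y $ l))) (y $ k))"

definition mat_rank :: "real mat \<Rightarrow> nat" where
  "mat_rank M = vec_space.rank (dim_row M) M"

definition full_rank :: "real mat \<Rightarrow> bool" where
  "full_rank M \<longleftrightarrow> mat_rank M = min (dim_row M) (dim_col M)"

text \<open>The inverse of an invertible square matrix; unspecified for all other matrices.\<close>

definition minv :: "real mat \<Rightarrow> real mat" where
  "minv M = the (mat_inverse M)"

text \<open>
  The rows of \<open>rows_of A J\<close> are those of \<open>A\<close> with index in \<open>J\<close>, in increasing order: row \<open>i\<close> comes from
  row \<^term>\<open>pick J i\<close> of \<open>A\<close>, where \<^term>\<open>pick J i\<close> is the \<open>i\<close>-th smallest element of \<open>J\<close>. A vector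
  indexed by \<open>J\<close> is represented in the same way: its \<open>i\<close>-th entry is the component with index
  \<^term>\<open>pick J i\<close>.
\<close>

definition rows_of :: "real mat \<Rightarrow> nat set \<Rightarrow> real mat" where
  "rows_of A J = submatrix A J UNIV"

definition entries_of :: "(nat \<Rightarrow> real vec \<Rightarrow> real) \<Rightarrow> nat set \<Rightarrow> real vec \<Rightarrow> real vec" where
  "entries_of b J x = vec (card J) (\<lambda>i. b (pick J i) x)"

text \<open>\<open>0 \<le> u \<bottom> v \<ge> 0\<close> for scalars and for vectors.\<close>

definition compl :: "real \<Rightarrow> real \<Rightarrow> bool" where
  "compl u v \<longleftrightarrow> 0 \<le> u \<and> 0 \<le> v \<and> u * v = 0"

definition compl_vec :: "real vec \<Rightarrow> real vec \<Rightarrow> bool" where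
  "compl_vec u v \<longleftrightarrow> 0\<^sub>v (dim_vec u) \<le> u \<and> 0\<^sub>v (dim_vec u) \<le> v \<and> u \<bullet> v = 0"

definition feasible_set ::
    "nat \<Rightarrow> nat \<Rightarrow> 'i set \<Rightarrow> ('i \<Rightarrow> real vec \<Rightarrow> real) \<Rightarrow> real mat \<Rightarrow> (nat \<Rightarrow> real vec \<Rightarrow> real) \<Rightarrow>
     (real vec \<times> real vec) set" where
  "feasible_set n p I h A b =
     {(x, y). x \<in> carrier_vec n \<and> y \<in> carrier_vec p \<and>
        (\<forall>i\<in>I. h i (x @\<^sub>v y) \<ge> 0) \<and> (\<forall>j<dim_row A. row A j \<bullet> y - b j x \<ge> 0)}"

definition bases :: "real mat \<Rightarrow> nat set set" where
  "bases A = {J. J \<subseteq> {..<dim_row A} \<and> card J = mat_rank A \<and> full_rank (rows_of A J)}"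

definition KKT_set ::
    "nat \<Rightarrow> nat \<Rightarrow> 'i set \<Rightarrow> ('i \<Rightarrow> real vec \<Rightarrow> real) \<Rightarrow> real mat \<Rightarrow> (nat \<Rightarrow> real vec \<Rightarrow> real) \<Rightarrow>
     (real vec \<Rightarrow> real) \<Rightarrow> nat set \<Rightarrow> (real vec \<times> real vec) set" where
  "KKT_set n p I h A b f J =
     {(x, y) \<in> feasible_set n p I h A b.
        \<exists>lam \<in> carrier_vec (mat_rank A).
          grad_y f x y - (rows_of A J)\<^sup>T *\<^sub>v lam = 0\<^sub>v p \<and>
          (\<forall>i<card J. compl (row A (pick J i) \<bullet> y - b (pick J i) x) (lam $ i))}"

definition multiplier ::
    "real mat \<Rightarrow> (real vec \<Rightarrow> real) \<Rightarrow> nat set \<Rightarrow> real vec \<Rightarrow> real vec \<Rightarrow> real vec" where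
  "multiplier A f J x y =
     minv (rows_of A J * (rows_of A J)\<^sup>T) *\<^sub>v (rows_of A J *\<^sub>v grad_y f x y)"

end

theory Submission
  imports Defs
begin

text \<open>
  Fix \<open>J\<close>, write \<open>B = A\<^sub>J\<close> and \<open>g = \<nabla>\<^sub>yf(x, y)\<close>. The existential quantifier over the multiplier in
  \<^term>\<open>KKT_set\<close> can be removed because \<open>B\<close> has full row rank: a solution \<open>\<lambda>\<close> of \<open>B\<^sup>T \<lambda> = g\<close> satisfies
  \<open>(B B\<^sup>T) \<lambda> = B g\<close>, and the Gram matrix \<open>B B\<^sup>T\<close> is invertible, so \<open>\<lambda>\<close> can only be the vector
  \<^term>\<open>multiplier\<close>. Conversely, \<^term>\<open>multiplier\<close> itself is an admissible witness as soon as it solves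
  \<open>B\<^sup>T \<lambda> = g\<close>, which has to be required because \<open>g\<close> need not lie in the row space of \<open>B\<close>.
  If \<open>A\<close> has rank \<open>p\<close>, then \<open>B\<^sup>T\<close> is square and invertible, the equation is always solvable, and its
  solution is \<open>B\<^sup>-\<^sup>T g\<close>.

  Both invertibility claims come from the injectivity of \<open>B\<^sup>T\<close>
  (\<open>full_row_rank_transpose_kernel\<close>), for the Gram matrix by way of \<open>full_row_rank_gram_det\<close>.
\<close>

text \<open>
  Full row rank is given as a statement about columns: the \<open>t\<close> rows have length \<open>p\<close>, and the \<open>p\<close> columns
  span a space of dimension \<open>t\<close>. So \<open>t\<close> linearly independent columns form an invertible matrix \<open>C\<close>,
  and \<open>B\<^sup>T v = 0\<close> contains the equations \<open>C\<^sup>T v = 0\<close>.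
\<close>

lemma full_row_rank_transpose_kernel:
  fixes B :: "'a :: field mat"
  assumes B: "B \<in> carrier_mat t p" and rank: "vec_space.rank t B = t"
    and v: "v \<in> carrier_vec t" and Bv: "B\<^sup>T *\<^sub>v v = 0\<^sub>v p"
  shows "v = 0\<^sub>v t"
proof -
  interpret vec_space "TYPE('a)" t .
  let ?indep = "\<lambda>T. T \<subseteq> set (cols B) \<and> lin_indpt T"
  have "?indep {}"
    using finite_lin_indpt2 by force
  then obtain U where U: "finite U" "maximal U ?indep"
    using maximal_exists_superset[of "set (cols B)" ?indep "{}"] by auto
  then have card: "card U = t" and sub: "U \<subseteq> set (cols B)" and indep: "lin_indpt U"
    using rank_card_indpt[OF B, of U] rank by (auto simp: maximal_def)
  obtain us where us: "set us = U" "distinct us"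
    using finite_distinct_list[OF U(1)] by auto
  then have len: "length us = t"
    using card distinct_card by fastforce
  have carr: "set us \<subseteq> carrier_vec t"
    using sub us B cols_dim by blast
  define C where "C = mat_of_cols t us"
  have C: "C \<in> carrier_mat t t" and cols_C: "cols C = us"
    using len carr by (auto simp: C_def)
  have "rank C = t"
    using lin_indpt_full_rank[OF C] us indep cols_C by simp
  then have "det (C\<^sup>T) \<noteq> 0"
    using det_rank_iff[OF C] det_transpose[OF C] by simp
  moreover have "C\<^sup>T *\<^sub>v v = 0\<^sub>v t"
  proof (rule eq_vecI)
    fix i assume "i < dim_vec (0\<^sub>v t :: 'a vec)"
    then have i: "i < t" by simp
    then have "col C i \<in> set (cols B)"
      using sub us len cols_C C by (metis carrier_matD(2) cols_length cols_nth nth_mem subsetD)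
    then obtain k where k: "k < p" "col C i = col B k"
      using B by (auto simp: cols_def)
    have "col B k \<bullet> v = (B\<^sup>T *\<^sub>v v) $ k"
      using k B by simp
    with Bv k i C show "(C\<^sup>T *\<^sub>v v) $ i = 0\<^sub>v t $ i"
      by simp
  qed (use C in simp)
  ultimately show ?thesis
    using det_0_iff_vec_prod_zero[of "C\<^sup>T" t] C v by auto
qed

text \<open>
  Over the reals, \<open>B B\<^sup>T v = 0\<close> implies \<open>\<parallel>B\<^sup>T v\<parallel>\<^sup>2 = v\<^sup>T B B\<^sup>T v = 0\<close>, hence \<open>B\<^sup>T v = 0\<close>.
\<close>

lemma full_row_rank_gram_det:
  fixes B :: "real mat"
  assumes B: "B \<in> carrier_mat t p" and rank: "vec_space.rank t B = t"
  shows "det (B * B\<^sup>T) \<noteq> 0"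
proof
  have G: "B * B\<^sup>T \<in> carrier_mat t t"
    using B by simp
  assume "det (B * B\<^sup>T) = 0"
  then obtain v where v: "v \<in> carrier_vec t" "v \<noteq> 0\<^sub>v t" "(B * B\<^sup>T) *\<^sub>v v = 0\<^sub>v t"
    using det_0_iff_vec_prod_zero[OF G] by auto
  have w: "B\<^sup>T *\<^sub>v v \<in> carrier_vec p"
    using B v by simp
  have "B *\<^sub>v (B\<^sup>T *\<^sub>v v) = 0\<^sub>v t"
    using v assoc_mult_mat_vec[of B t p "B\<^sup>T" t v] B by simp
  then have "(B\<^sup>T *\<^sub>v v) \<bullet> (B\<^sup>T *\<^sub>v v) = 0"
    using transpose_vec_mult_scalar[OF B w v(1)] v(1) by simp
  then have "B\<^sup>T *\<^sub>v v = 0\<^sub>v p"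
    using conjugate_square_eq_0_vec[OF w] by (simp add: conjugate_vec_def conjugate_real_def)
  then show False
    using full_row_rank_transpose_kernel[OF B rank v(1)] v(2) by simp
qed

lemma minv_inverse:
  assumes M: "M \<in> carrier_mat k k" and det: "det M \<noteq> 0"
  shows "M * minv M = 1\<^sub>m k" "minv M * M = 1\<^sub>m k" "minv M \<in> carrier_mat k k"
proof -
  have "mat_inverse M \<noteq> None"
    using mat_inverse(1)[OF M, of "()"] det_non_zero_imp_unit[OF M det, of "()"] by blast
  then obtain N where "mat_inverse M = Some N"
    by blast
  then show "M * minv M = 1\<^sub>m k" "minv M * M = 1\<^sub>m k" "minv M \<in> carrier_mat k k"
    using mat_inverse(2)[OF M] by (auto simp: minv_def)
qed

lemma minv_mult_eq_iff:
  assumes M: "M \<in> carrier_mat k k" and det: "det M \<noteq> 0"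
    and u: "u \<in> carrier_vec k" and w: "w \<in> carrier_vec k"
  shows "M *\<^sub>v u = w \<longleftrightarrow> u = minv M *\<^sub>v w"
proof -
  note inv = minv_inverse[OF M det]
  have "minv M *\<^sub>v (M *\<^sub>v u) = u" "M *\<^sub>v (minv M *\<^sub>v w) = w"
    using assoc_mult_mat_vec[OF inv(3) M u] assoc_mult_mat_vec[OF M inv(3) w] inv u w by simp_all
  then show ?thesis by auto
qed

lemma compl_vec_iff:
  assumes u: "u \<in> carrier_vec k" and v: "v \<in> carrier_vec k"
  shows "compl_vec u v \<longleftrightarrow> (\<forall>i<k. compl (u $ i) (v $ i))"
proof (cases "\<forall>i<k. 0 \<le> u $ i \<and> 0 \<le> v $ i")
  case True
  then have "(\<Sum>i<k. u $ i * v $ i) = 0 \<longleftrightarrow> (\<forall>i\<in>{..<k}. u $ i * v $ i = 0)"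
    by (intro sum_nonneg_eq_0_iff) auto
  then have "u \<bullet> v = 0 \<longleftrightarrow> (\<forall>i<k. u $ i * v $ i = 0)"
    using v by (auto simp: scalar_prod_def atLeast0LessThan)
  with True show ?thesis
    using u v by (auto simp: compl_vec_def compl_def less_eq_vec_def)
next
  case False
  then show ?thesis
    using u v by (auto simp: compl_vec_def compl_def less_eq_vec_def)
qed

text \<open>
  A member \<open>J\<close> of \<^term>\<open>bases A\<close> has \<open>rank A \<le> p\<close> elements, so the full rank of \<open>A\<^sub>J\<close> is its number of rows.
\<close>

lemma rows_of_bases:
  assumes A: "A \<in> carrier_mat m p" and J: "J \<in> bases A"
  shows "rows_of A J \<in> carrier_mat (mat_rank A) p"
    and "vec_space.rank (mat_rank A) (rows_of A J) = mat_rank A"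
    and "card J = mat_rank A"
    and "i < card J \<Longrightarrow> row (rows_of A J) i = row A (pick J i)"
proof -
  have sub: "J \<subseteq> {..<m}" and card: "card J = mat_rank A" and full: "full_rank (rows_of A J)"
    using J A by (auto simp: bases_def)
  have Jset: "{i. i < dim_row A \<and> i \<in> J} = J"
    using sub A by auto
  show B: "rows_of A J \<in> carrier_mat (mat_rank A) p"
    using A Jset card unfolding rows_of_def carrier_mat_def by (simp add: dim_submatrix)
  have "mat_rank A \<le> p"
    using vec_space.rank_le_nc[OF A] A by (simp add: mat_rank_def)
  then show "vec_space.rank (mat_rank A) (rows_of A J) = mat_rank A"
    using full B by (simp add: full_rank_def mat_rank_def[of "rows_of A J"])
  show "card J = mat_rank A" by (rule card)
  show "row (rows_of A J) i = row A (pick J i)" if "i < card J"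
  proof (rule eq_vecI)
    have pick: "pick J i < m"
      using pick_in_set_le[OF that] sub by auto
    show "dim_vec (row (rows_of A J) i) = dim_vec (row A (pick J i))"
      using A B by simp
    fix j assume "j < dim_vec (row A (pick J i))"
    then have j: "j < p" using A by simp
    then show "row (rows_of A J) i $ j = row A (pick J i) $ j"
      using that A B pick card Jset submatrix_index[of i A J j UNIV]
      by (simp add: rows_of_def pick_UNIV)
  qed
qed

text \<open>
  Multiplying \<open>B\<^sup>T \<lambda> = g\<close> by \<open>B\<close> gives the normal equations \<open>(B B\<^sup>T) \<lambda> = B g\<close>, which have only one solution.
\<close>

lemma multiplier_unique:
  assumes A: "A \<in> carrier_mat m p" and J: "J \<in> bases A"
    and lam: "lam \<in> carrier_vec (mat_rank A)"
    and eq: "(rows_of A J)\<^sup>T *\<^sub>v lam = grad_y f x y"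
  shows "lam = multiplier A f J x y"
proof -
  let ?B = "rows_of A J" and ?t = "mat_rank A"
  note B = rows_of_bases(1)[OF A J]
  note det = full_row_rank_gram_det[OF B rows_of_bases(2)[OF A J]]
  have "(?B * ?B\<^sup>T) *\<^sub>v lam = ?B *\<^sub>v grad_y f x y"
    using assoc_mult_mat_vec[of ?B ?t p "?B\<^sup>T" ?t lam] B lam eq by simp
  moreover have "?B *\<^sub>v grad_y f x y \<in> carrier_vec ?t"
    using B by (intro carrier_vecI) simp
  ultimately show ?thesis
    using minv_mult_eq_iff[of "?B * ?B\<^sup>T" ?t lam "?B *\<^sub>v grad_y f x y"] det B lam
    unfolding multiplier_def by simp
qed

lemma multiplier_carrier:
  assumes A: "A \<in> carrier_mat m p" and J: "J \<in> bases A"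
  shows "multiplier A f J x y \<in> carrier_vec (mat_rank A)"
proof -
  note B = rows_of_bases(1)[OF A J]
  note det = full_row_rank_gram_det[OF B rows_of_bases(2)[OF A J]]
  have "minv (rows_of A J * (rows_of A J)\<^sup>T) \<in> carrier_mat (mat_rank A) (mat_rank A)"
    using minv_inverse(3)[OF _ det] B by auto
  then show ?thesis
    by (intro carrier_vecI) (simp add: multiplier_def)
qed

lemma KKT_set_iff:
  assumes A: "A \<in> carrier_mat m p" and J: "J \<in> bases A"
  shows "(x, y) \<in> KKT_set n p I h A b f J \<longleftrightarrow>
    (x, y) \<in> feasible_set n p I h A b \<and>
    (\<exists>lam \<in> carrier_vec (mat_rank A). (rows_of A J)\<^sup>T *\<^sub>v lam = grad_y f x y \<and>
       (\<forall>i<card J. compl (row A (pick J i) \<bullet> y - b (pick J i) x) (lam $ i)))"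
proof -
  have "grad_y f x y - (rows_of A J)\<^sup>T *\<^sub>v lam = 0\<^sub>v p \<longleftrightarrow> (rows_of A J)\<^sup>T *\<^sub>v lam = grad_y f x y"
    if y: "y \<in> carrier_vec p" for lam
  proof -
    have "grad_y f x y \<in> carrier_vec p" "(rows_of A J)\<^sup>T *\<^sub>v lam \<in> carrier_vec p"
      using y rows_of_bases(1)[OF A J] by (auto simp: grad_y_def intro!: carrier_vecI)
    then show ?thesis
      by (auto simp: vec_eq_iff)
  qed
  then show ?thesis
    by (auto simp: KKT_set_def feasible_set_def)
qed

lemma KKT_set_eq_multiplier:
  assumes A: "A \<in> carrier_mat m p" and J: "J \<in> bases A"
  shows "KKT_set n p I h A b f J =
    {(x, y) \<in> feasible_set n p I h A b.
       (rows_of A J)\<^sup>T *\<^sub>v multiplier A f J x y = grad_y f x y \<and>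
       (\<forall>i<card J. compl (row A (pick J i) \<bullet> y - b (pick J i) x) (multiplier A f J x y $ i))}"
  (is "_ = ?R")
proof -
  have "(x, y) \<in> KKT_set n p I h A b f J \<longleftrightarrow> (x, y) \<in> ?R" for x y
    unfolding KKT_set_iff[OF A J]
    using multiplier_unique[OF A J, of _ f x y] multiplier_carrier[OF A J, of f x y] by auto
  then show ?thesis by auto
qed

text \<open>
  If \<open>rank A = p\<close>, then \<open>A\<^sub>J\<^sup>T\<close> is a square matrix with trivial kernel, hence invertible.
\<close>

lemma KKT_set_eq_transpose_inverse:
  assumes A: "A \<in> carrier_mat m p" and J: "J \<in> bases A" and rank: "mat_rank A = p"
  shows "KKT_set n p I h A b f J =
    {(x, y) \<in> feasible_set n p I h A b.
       compl_vec (rows_of A J *\<^sub>v y - entries_of b J x)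
                 (minv ((rows_of A J)\<^sup>T) *\<^sub>v grad_y f x y)}"
  (is "_ = ?R")
proof -
  let ?B = "rows_of A J"
  note rows = rows_of_bases[OF A J, unfolded rank]
  have BT: "?B\<^sup>T \<in> carrier_mat p p"
    using rows(1) by simp
  have det: "det (?B\<^sup>T) \<noteq> 0"
    using full_row_rank_transpose_kernel[OF rows(1,2)] det_0_iff_vec_prod_zero[OF BT] by auto
  have "(x, y) \<in> KKT_set n p I h A b f J \<longleftrightarrow> (x, y) \<in> ?R" for x y
  proof (cases "(x, y) \<in> feasible_set n p I h A b")
    case True
    then have y: "y \<in> carrier_vec p"
      by (simp add: feasible_set_def)
    let ?l = "minv (?B\<^sup>T) *\<^sub>v grad_y f x y"
    have g: "grad_y f x y \<in> carrier_vec p"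
      using y by (auto simp: grad_y_def intro!: carrier_vecI)
    have l: "?l \<in> carrier_vec p"
      using minv_inverse(3)[OF BT det] g by simp
    have u: "?B *\<^sub>v y - entries_of b J x \<in> carrier_vec p"
      using rows(1,3) by (intro carrier_vecI) (simp add: entries_of_def)
    have entry: "(?B *\<^sub>v y - entries_of b J x) $ i = row A (pick J i) \<bullet> y - b (pick J i) x"
      if "i < p" for i
      using that rows by (simp add: entries_of_def)
    have "(x, y) \<in> KKT_set n p I h A b f J \<longleftrightarrow>
        (\<exists>lam \<in> carrier_vec p. lam = ?l \<and>
          (\<forall>i<p. compl (row A (pick J i) \<bullet> y - b (pick J i) x) (lam $ i)))"
      using minv_mult_eq_iff[OF BT det _ g] True
      unfolding KKT_set_iff[OF A J] rank rows(3) by blast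
    also have "\<dots> \<longleftrightarrow> compl_vec (?B *\<^sub>v y - entries_of b J x) ?l"
      unfolding compl_vec_iff[OF u l] using l entry by auto
    finally show ?thesis
      using True by simp
  qed (simp add: KKT_set_def)
  then show ?thesis by auto
qed

theorem proposition2p3:
  fixes n p m :: nat
    and I :: "'i set"
    and f :: "real vec \<Rightarrow> real"
    and h :: "'i \<Rightarrow> real vec \<Rightarrow> real"
    and A :: "real mat"
    and b :: "nat \<Rightarrow> real vec \<Rightarrow> real"
  assumes "n \<ge> 1" and "p \<ge> 1" and "m \<ge> 1"
    and "finite I"
    and "real_polynomial (n + p) f"
    and "\<And>i. i \<in> I \<Longrightarrow> real_polynomial (n + p) (h i)"
    and "A \<in> carrier_mat m p"
    and "\<And>j. j < m \<Longrightarrow> real_polynomial n (b j)"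
  shows
    "\<forall>J \<in> bases A.
       KKT_set n p I h A b f J =
         {(x, y) \<in> feasible_set n p I h A b.
            (rows_of A J)\<^sup>T *\<^sub>v multiplier A f J x y = grad_y f x y \<and>
            (\<forall>i<card J. compl (row A (pick J i) \<bullet> y - b (pick J i) x) (multiplier A f J x y $ i))} \<and>
       (mat_rank A = p \<longrightarrow>
          KKT_set n p I h A b f J =
            {(x, y) \<in> feasible_set n p I h A b.
               compl_vec (rows_of A J *\<^sub>v y - entries_of b J x)
                         (minv ((rows_of A J)\<^sup>T) *\<^sub>v grad_y f x y)})"
  using KKT_set_eq_multiplier[OF assms(7)] KKT_set_eq_transpose_inverse[OF assms(7)] by blast

end
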